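(* Let $\mathcal M=(M,\rho)$ be a finite additive pseudo-metric space. Among the weighted trees $\mathcal G=(G,\omega)$ joining $M$ such that all vertices of $G$ of degree $1$ and $2$ belong to $M$, the minimal fillings of $\mathcal M$ are exactly the generating trees of $\mathcal M$.
   Context: In a pseudo-metric space the distance between distinct points may be $0$. A finite graph $G=(V,E)$ joins $M$ if it is connected and $M\subset V$. A weighted tree $(G,\omega)$ is a tree with a weight function $\omega:E\to[0,\infty)$. For a weighted graph, $d_\omega(u,v)$ is the least weight (sum of $\omega$ over edges) of a path in $G$ joining $u$ and $v$, and $\omega(G)=\sum_{e\in E}\omega(e)$. The weighted graph $(G,\omega)$ is a filling of $\mathcal M=(M,\rho)$ if $G$ joins $M$ and $\rho(p,q)\le d_\omega(p,q)$ for all $p,q\in M$. $\mathrm{mf}(\mathcal M)$ is the infimum of $\omega(G)$ over all fillings of $\mathcal M$ (over all connected graphs $G$ joining $M$), and a minimal filling is a filling with $\omega(G)=\mathrm{mf}(\mathcal M)$. A finite pseudo-metric space $(M,\rho)$ is additive if there exists a weighted tree $(G,\omega)$ joining $M$, all of whose vertices of degree $1$ and $2$ belong to $M$, such that $\rho$ coincides with the restriction of $d_\omega$ to $M$; each such weighted tree is called a generating tree of $(M,\rho)$. *)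

theory Defs
  imports Complex_Main "HOL-Library.Infinite_Typeclass"
begin

text \<open>
  Graphs are finite, simple and undirected: a vertex set \<open>V\<close> and a set \<open>E\<close> of two-element
  subsets of \<open>V\<close>.  A weight function is a total function on sets of which only the values on
  \<open>E\<close> matter.
\<close>

definition finite_graph :: "'a set \<Rightarrow> 'a set set \<Rightarrow> bool" where
  "finite_graph V E \<longleftrightarrow> finite V \<and> (\<forall>e\<in>E. e \<subseteq> V \<and> card e = 2)"

definition graph_path :: "'a set \<Rightarrow> 'a set set \<Rightarrow> 'a list \<Rightarrow> bool" where
  "graph_path V E p \<longleftrightarrow>
     p \<noteq> [] \<and> set p \<subseteq> V \<and> distinct p \<and> successively (\<lambda>x y. {x, y} \<in> E) p"

definition joining_paths :: "'a set \<Rightarrow> 'a set set \<Rightarrow> 'a \<Rightarrow> 'a \<Rightarrow> 'a list set" where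
  "joining_paths V E u v = {p. graph_path V E p \<and> hd p = u \<and> last p = v}"

definition connected_graph :: "'a set \<Rightarrow> 'a set set \<Rightarrow> bool" where
  "connected_graph V E \<longleftrightarrow>
     finite_graph V E \<and> V \<noteq> {} \<and> (\<forall>u\<in>V. \<forall>v\<in>V. joining_paths V E u v \<noteq> {})"

definition graph_cycle :: "'a set \<Rightarrow> 'a set set \<Rightarrow> 'a list \<Rightarrow> bool" where
  "graph_cycle V E p \<longleftrightarrow> graph_path V E p \<and> 3 \<le> length p \<and> {last p, hd p} \<in> E"

definition graph_tree :: "'a set \<Rightarrow> 'a set set \<Rightarrow> bool" where
  "graph_tree V E \<longleftrightarrow> connected_graph V E \<and> (\<nexists>p. graph_cycle V E p)"

definition degree :: "'a set set \<Rightarrow> 'a \<Rightarrow> nat" where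
  "degree E v = card {e \<in> E. v \<in> e}"

definition joins :: "'a set \<Rightarrow> 'a set set \<Rightarrow> 'a set \<Rightarrow> bool" where
  "joins V E M \<longleftrightarrow> connected_graph V E \<and> M \<subseteq> V"

definition weight_function :: "'a set set \<Rightarrow> ('a set \<Rightarrow> real) \<Rightarrow> bool" where
  "weight_function E \<omega> \<longleftrightarrow> (\<forall>e\<in>E. 0 \<le> \<omega> e)"

definition graph_weight :: "'a set set \<Rightarrow> ('a set \<Rightarrow> real) \<Rightarrow> real" where
  "graph_weight E \<omega> = (\<Sum>e\<in>E. \<omega> e)"

definition path_weight :: "('a set \<Rightarrow> real) \<Rightarrow> 'a list \<Rightarrow> real" where
  "path_weight \<omega> p = (\<Sum>(x, y)\<leftarrow>zip p (tl p). \<omega> {x, y})"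

text \<open>
  Paths do not repeat vertices, so a finite graph has finitely many of them; in a connected
  graph the minimum is therefore over a finite nonempty set.  The one-vertex path gives
  distance \<open>0\<close> from a vertex to itself.
\<close>

definition graph_dist :: "'a set \<Rightarrow> 'a set set \<Rightarrow> ('a set \<Rightarrow> real) \<Rightarrow> 'a \<Rightarrow> 'a \<Rightarrow> real" where
  "graph_dist V E \<omega> u v = Min (path_weight \<omega> ` joining_paths V E u v)"

definition finite_pseudo_metric_space :: "'a set \<Rightarrow> ('a \<Rightarrow> 'a \<Rightarrow> real) \<Rightarrow> bool" where
  "finite_pseudo_metric_space M \<rho> \<longleftrightarrow>
     finite M \<and>
     (\<forall>x\<in>M. \<rho> x x = 0) \<and>
     (\<forall>x\<in>M. \<forall>y\<in>M. 0 \<le> \<rho> x y \<and> \<rho> x y = \<rho> y x) \<and>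
     (\<forall>x\<in>M. \<forall>y\<in>M. \<forall>z\<in>M. \<rho> x z \<le> \<rho> x y + \<rho> y z)"

text \<open>
  A filling may use any finite number of vertices outside \<open>M\<close>.  The points of \<open>M\<close> and the
  additional vertices are drawn from one infinite type, so that every finite graph joining \<open>M\<close>
  has an isomorphic copy, fixing \<open>M\<close>, among the graphs over this type.
\<close>

definition filling ::
  "'a::infinite set \<Rightarrow> ('a \<Rightarrow> 'a \<Rightarrow> real) \<Rightarrow> 'a set \<Rightarrow> 'a set set \<Rightarrow> ('a set \<Rightarrow> real) \<Rightarrow> bool" where
  "filling M \<rho> V E \<omega> \<longleftrightarrow>
     joins V E M \<and> weight_function E \<omega> \<and> (\<forall>p\<in>M. \<forall>q\<in>M. \<rho> p q \<le> graph_dist V E \<omega> p q)"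

definition mf :: "'a::infinite set \<Rightarrow> ('a \<Rightarrow> 'a \<Rightarrow> real) \<Rightarrow> real" where
  "mf M \<rho> = Inf {graph_weight E \<omega> | V E \<omega>. filling M \<rho> V E \<omega>}"

definition minimal_filling ::
  "'a::infinite set \<Rightarrow> ('a \<Rightarrow> 'a \<Rightarrow> real) \<Rightarrow> 'a set \<Rightarrow> 'a set set \<Rightarrow> ('a set \<Rightarrow> real) \<Rightarrow> bool" where
  "minimal_filling M \<rho> V E \<omega> \<longleftrightarrow> filling M \<rho> V E \<omega> \<and> graph_weight E \<omega> = mf M \<rho>"

definition admissible_weighted_tree ::
  "'a::infinite set \<Rightarrow> 'a set \<Rightarrow> 'a set set \<Rightarrow> ('a set \<Rightarrow> real) \<Rightarrow> bool" where
  "admissible_weighted_tree M V E \<omega> \<longleftrightarrow>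
     graph_tree V E \<and> weight_function E \<omega> \<and> joins V E M \<and>
     (\<forall>v\<in>V. degree E v = 1 \<or> degree E v = 2 \<longrightarrow> v \<in> M)"

definition generating_tree ::
  "'a::infinite set \<Rightarrow> ('a \<Rightarrow> 'a \<Rightarrow> real) \<Rightarrow> 'a set \<Rightarrow> 'a set set \<Rightarrow> ('a set \<Rightarrow> real) \<Rightarrow> bool" where
  "generating_tree M \<rho> V E \<omega> \<longleftrightarrow>
     admissible_weighted_tree M V E \<omega> \<and> (\<forall>p\<in>M. \<forall>q\<in>M. \<rho> p q = graph_dist V E \<omega> p q)"

definition additive_space :: "'a::infinite set \<Rightarrow> ('a \<Rightarrow> 'a \<Rightarrow> real) \<Rightarrow> bool" where
  "additive_space M \<rho> \<longleftrightarrow>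
     finite_pseudo_metric_space M \<rho> \<and> (\<exists>V E \<omega>. generating_tree M \<rho> V E \<omega>)"

end

theory Submission
  imports Defs
begin

text \<open>
  The argument compares closed chains, that is, cyclic sequences of points that list all of
  \<open>M\<close>, possibly with repetitions.

  In an admissible weighted tree every edge \<open>e\<close> is the only edge across some cut, and each side
  of this cut contains a leaf and hence a point of \<open>M\<close>.  A closed chain listing \<open>M\<close> therefore
  crosses each cut at least twice, so its length in the tree metric is at least twice the
  weight of the tree.  For a generating tree this is a lower bound on the \<open>\<rho>\<close>-length of every
  closed chain listing \<open>M\<close> (\<open>generating_tree_closed_chain_ge\<close>).

  Conversely, let \<open>(V, E, \<omega>)\<close> be any filling and let \<open>p\<close> and \<open>q\<close> be points of \<open>M\<close>.  A shortest
  path from \<open>p\<close> to \<open>q\<close> can be closed up by going back along it with detours to all other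
  vertices, and the resulting closed walk weighs at most twice the weight of the graph
  (\<open>covering_walk\<close>).  Only the points of \<open>M\<close> on the way back are kept, and there \<open>\<rho>\<close> is bounded
  by the graph distance \<open>d\<close>.  This yields a chain \<open>m\<close> from \<open>q\<close> to \<open>p\<close> that lists \<open>M\<close> and
  satisfies \<open>d p q + \<rho>(m) \<le> 2 \<omega>(E)\<close>, where \<open>\<rho>(m)\<close> is the \<open>\<rho>\<close>-length of \<open>m\<close>
  (\<open>filling_closed_chain\<close>).

  Let \<open>w\<close> be the weight of a generating tree.  Together the two bounds give
  \<open>2 w \<le> \<rho>(m) + \<rho> p q\<close> and \<open>\<rho>(m) + d p q \<le> 2 \<omega>(E)\<close>.  Since \<open>\<rho> p q \<le> d p q\<close>, it follows that
  \<open>w \<le> \<omega>(E)\<close>: generating trees are minimal fillings.  If the filling is minimal as well, then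
  \<open>\<omega>(E) = w\<close>, and the same bounds give \<open>d p q \<le> \<rho> p q\<close>.  As \<open>p\<close> and \<open>q\<close> are arbitrary, \<open>d\<close> and
  \<open>\<rho>\<close> agree on \<open>M\<close>.
\<close>

section \<open>Sums along lists\<close>

text \<open>
  The sum of a function of two arguments over the consecutive pairs of a list; the weight of a
  path is the special case \<open>f x y = \<omega> {x, y}\<close>.
\<close>

fun chain_sum :: "('a \<Rightarrow> 'a \<Rightarrow> real) \<Rightarrow> 'a list \<Rightarrow> real" where
  "chain_sum f (x # y # zs) = f x y + chain_sum f (y # zs)"
| "chain_sum f [x] = 0"
| "chain_sum f [] = 0"

lemma path_weight_eq_chain_sum: "path_weight \<omega> p = chain_sum (\<lambda>x y. \<omega> {x, y}) p"
  by (induction "\<lambda>x y. \<omega> {x, y}" p rule: chain_sum.induct) (auto simp: path_weight_def)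

lemma chain_sum_append:
  "chain_sum f (xs @ y # zs) = chain_sum f (xs @ [y]) + chain_sum f (y # zs)"
  by (induction f xs rule: chain_sum.induct) auto

lemma chain_sum_rev:
  assumes "\<And>x y. f x y = f y x"
  shows "chain_sum f (rev p) = chain_sum f p"
proof (induction p)
  case (Cons x p)
  show ?case
  proof (cases p)
    case (Cons y q)
    have "chain_sum f (rev (x # p)) = chain_sum f (rev q @ y # [x])"
      using Cons by simp
    also have "\<dots> = chain_sum f (rev p) + f y x"
      using Cons by (subst chain_sum_append) simp
    finally show ?thesis
      using Cons Cons.IH assms by simp
  qed simp
qed simp

lemma chain_sum_mono:
  assumes "\<And>x y. x \<in> set p \<Longrightarrow> y \<in> set p \<Longrightarrow> f x y \<le> g x y"
  shows "chain_sum f p \<le> chain_sum g p"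
  using assms by (induction f p rule: chain_sum.induct) (auto intro!: add_mono)

lemma chain_sum_mono_successively:
  assumes "successively R p" "\<And>x y. R x y \<Longrightarrow> x \<in> set p \<Longrightarrow> y \<in> set p \<Longrightarrow> f x y \<le> g x y"
  shows "chain_sum f p \<le> chain_sum g p"
  using assms by (induction f p rule: chain_sum.induct) (auto intro!: add_mono)

lemma chain_sum_sum:
  "chain_sum (\<lambda>x y. \<Sum>e\<in>F. c e * f e x y) p = (\<Sum>e\<in>F. c e * chain_sum (f e) p)"
proof (induction p rule: induct_list012)
  case (3 x y zs)
  then show ?case by (simp add: sum.distrib distrib_left)
qed simp_all

lemma triangle_chain_sum:
  assumes "\<And>x y z. f x z \<le> f x y + f y z" "\<And>x. f x x = 0" "p \<noteq> []"
  shows "f (hd p) (last p) \<le> chain_sum f p"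
  using assms(3)
proof (induction p rule: induct_list012)
  case (3 x y zs)
  then show ?case using assms(1)[of x "last (y # zs)" y] by simp
qed (simp_all add: assms(2))

text \<open>
  A closed chain that starts at its head and passes through \<open>x\<close> covers the distance from its
  head to \<open>x\<close> twice.
\<close>

lemma closed_chain_ge:
  assumes tri: "\<And>x y z. f x z \<le> f x y + f y z" and refl: "\<And>x. f x x = 0"
    and sym: "\<And>x y. f x y = f y x" and "x \<in> set p"
  shows "2 * f (hd p) x \<le> chain_sum f p + f (last p) (hd p)"
proof -
  obtain ys zs where p: "p = ys @ x # zs"
    using \<open>x \<in> set p\<close> by (auto simp: in_set_conv_decomp)
  have "f (hd (ys @ [x])) (last (ys @ [x])) \<le> chain_sum f (ys @ [x])"
    by (rule triangle_chain_sum[OF tri refl]) simp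
  moreover have "f (hd (x # zs)) (last (x # zs)) \<le> chain_sum f (x # zs)"
    by (rule triangle_chain_sum[OF tri refl]) simp
  moreover have "hd (ys @ [x]) = hd p" "last (x # zs) = last p"
    by (cases ys; simp add: p) (simp add: p)
  moreover have "chain_sum f p = chain_sum f (ys @ [x]) + chain_sum f (x # zs)"
    unfolding p by (rule chain_sum_append)
  ultimately show ?thesis
    using tri[of x "hd p" "last p"] sym[of x "hd p"] by simp
qed

text \<open>Shortcuts do not lengthen a chain.\<close>

lemma chain_sum_filter_le:
  assumes tri: "\<And>x y z. \<lbrakk>x \<in> V; y \<in> V; z \<in> V\<rbrakk> \<Longrightarrow> f x z \<le> f x y + f y z"
    and nonneg: "\<And>x y. \<lbrakk>x \<in> V; y \<in> V\<rbrakk> \<Longrightarrow> 0 \<le> f x y"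
    and "set (x # xs) \<subseteq> V"
  shows "chain_sum f (x # filter Q xs) \<le> chain_sum f (x # xs)"
  using assms(3)
proof (induction xs arbitrary: x)
  case (Cons y ys)
  show ?case
  proof (cases "Q y")
    case True
    then show ?thesis using Cons by auto
  next
    case False
    have "chain_sum f (x # filter Q ys) \<le> chain_sum f (x # ys)"
      using Cons by auto
    also have "\<dots> \<le> chain_sum f (x # y # ys)"
    proof (cases ys)
      case Nil
      then show ?thesis using Cons.prems nonneg by auto
    next
      case ys: (Cons z zs)
      then show ?thesis using Cons.prems tri[of x y z] by auto
    qed
    finally show ?thesis using False by simp
  qed
qed simp

section \<open>Walks and distances in graphs\<close>

text \<open>A walk is a path whose vertices may repeat.\<close>

definition graph_walk :: "'a set \<Rightarrow> 'a set set \<Rightarrow> 'a list \<Rightarrow> bool" where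
  "graph_walk V E p \<longleftrightarrow> p \<noteq> [] \<and> set p \<subseteq> V \<and> successively (\<lambda>x y. {x, y} \<in> E) p"

lemma graph_path_iff_walk: "graph_path V E p \<longleftrightarrow> graph_walk V E p \<and> distinct p"
  by (auto simp: graph_path_def graph_walk_def)

lemma graph_walk_rev: "graph_walk V E p \<Longrightarrow> graph_walk V E (rev p)"
  by (simp add: graph_walk_def insert_commute)

lemma graph_walk_append:
  assumes "graph_walk V E p" "graph_walk V E q" "last p = hd q"
  shows "graph_walk V E (p @ tl q)" "hd (p @ tl q) = hd p" "last (p @ tl q) = last q"
    "path_weight \<omega> (p @ tl q) = path_weight \<omega> p + path_weight \<omega> q"
proof -
  obtain xs v where p: "p = xs @ [v]"
    using assms(1) by (cases p rule: rev_cases) (auto simp: graph_walk_def)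
  then obtain ys where q: "q = v # ys"
    using assms by (cases q) (auto simp: graph_walk_def)
  show "graph_walk V E (p @ tl q)" "hd (p @ tl q) = hd p" "last (p @ tl q) = last q"
    using assms by (auto simp: graph_walk_def p q successively_append_iff successively_Cons hd_append)
  show "path_weight \<omega> (p @ tl q) = path_weight \<omega> p + path_weight \<omega> q"
    using chain_sum_append[of _ xs v ys] by (simp add: path_weight_eq_chain_sum p q)
qed

lemma path_weight_nonneg:
  assumes "graph_walk V E p" "weight_function E \<omega>"
  shows "0 \<le> path_weight \<omega> p"
proof -
  have "successively (\<lambda>x y. {x, y} \<in> E) p" using assms by (simp add: graph_walk_def)
  then have "chain_sum (\<lambda>x y. 0) p \<le> path_weight \<omega> p"
    unfolding path_weight_eq_chain_sum
    by (rule chain_sum_mono_successively) (use assms in \<open>auto simp: weight_function_def\<close>)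
  moreover have "chain_sum (\<lambda>x y. 0) p = 0"
    by (induction p rule: induct_list012) auto
  ultimately show ?thesis by simp
qed

lemma walk_contains_path:
  assumes "graph_walk V E p" "weight_function E \<omega>"
  obtains q where "graph_path V E q" "hd q = hd p" "last q = last p"
    "path_weight \<omega> q \<le> path_weight \<omega> p"
  using assms
proof (induction "length p" arbitrary: p thesis rule: less_induct)
  case less
  show ?case
  proof (cases "distinct p")
    case True
    then show ?thesis using less.prems by (auto simp: graph_path_iff_walk)
  next
    case False
    then obtain xs ys zs y where p: "p = xs @ [y] @ ys @ [y] @ zs"
      using not_distinct_decomp by blast
    \<comment> \<open>The closed part between two visits of \<open>y\<close> is cut out.\<close>
    let ?p' = "xs @ y # zs"
    have w: "graph_walk V E ?p'" "graph_walk V E (y # ys @ [y])"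
      using less.prems(2) unfolding p graph_walk_def
      by (auto simp: successively_append_iff successively_Cons hd_append split: if_splits)
    have "path_weight \<omega> p = path_weight \<omega> (xs @ [y]) + path_weight \<omega> (y # ys @ y # zs)"
      unfolding path_weight_eq_chain_sum p using chain_sum_append[of _ xs y "ys @ y # zs"] by simp
    also have "path_weight \<omega> (y # ys @ y # zs)
        = path_weight \<omega> (y # ys @ [y]) + path_weight \<omega> (y # zs)"
      unfolding path_weight_eq_chain_sum using chain_sum_append[of _ "y # ys" y zs] by simp
    also have "path_weight \<omega> (xs @ [y]) + (\<dots>)
        = path_weight \<omega> ?p' + path_weight \<omega> (y # ys @ [y])"
      unfolding path_weight_eq_chain_sum chain_sum_append[of _ xs y zs] by simp
    finally have "path_weight \<omega> ?p' \<le> path_weight \<omega> p"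
      using path_weight_nonneg[OF w(2) less.prems(3)] by simp
    moreover have "hd ?p' = hd p" "last ?p' = last p" "length ?p' < length p"
      by (cases xs; simp add: p) (simp_all add: p)
    moreover obtain q where "graph_path V E q" "hd q = hd ?p'" "last q = last ?p'"
      "path_weight \<omega> q \<le> path_weight \<omega> ?p'"
      using less.hyps[OF \<open>length ?p' < length p\<close> _ w(1) less.prems(3)] by blast
    ultimately show ?thesis using less.prems(1)[of q] by simp
  qed
qed

lemma finite_joining_paths: "finite V \<Longrightarrow> finite (joining_paths V E u v)"
  by (rule finite_subset[OF _ finite_subset_distinct[of V]])
    (auto simp: joining_paths_def graph_path_def)

lemma graph_dist_le_walk:
  assumes "finite V" "weight_function E \<omega>" "graph_walk V E p"
  shows "graph_dist V E \<omega> (hd p) (last p) \<le> path_weight \<omega> p"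
proof -
  obtain q where q: "graph_path V E q" "hd q = hd p" "last q = last p"
    "path_weight \<omega> q \<le> path_weight \<omega> p"
    using walk_contains_path[OF assms(3,2)] .
  then have "graph_dist V E \<omega> (hd p) (last p) \<le> path_weight \<omega> q"
    unfolding graph_dist_def
    by (intro Min_le finite_imageI finite_joining_paths assms)
      (auto simp: joining_paths_def)
  with q show ?thesis by simp
qed

lemma graph_dist_attained:
  assumes "connected_graph V E" "u \<in> V" "v \<in> V"
  obtains p where "graph_path V E p" "hd p = u" "last p = v"
    "path_weight \<omega> p = graph_dist V E \<omega> u v"
proof -
  let ?S = "path_weight \<omega> ` joining_paths V E u v"
  have "finite V" using assms by (auto simp: connected_graph_def finite_graph_def)
  then have "Min ?S \<in> ?S"
    using assms by (intro Min_in) (auto simp: connected_graph_def finite_joining_paths)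
  then obtain p where "p \<in> joining_paths V E u v" "Min ?S = path_weight \<omega> p"
    by (rule imageE)
  then show ?thesis
    using that[of p] by (simp add: graph_dist_def joining_paths_def)
qed

lemma graph_dist_nonneg:
  assumes "connected_graph V E" "weight_function E \<omega>" "u \<in> V" "v \<in> V"
  shows "0 \<le> graph_dist V E \<omega> u v"
proof -
  obtain p where "graph_path V E p" "path_weight \<omega> p = graph_dist V E \<omega> u v"
    using graph_dist_attained[OF assms(1,3,4)] .
  then show ?thesis
    using path_weight_nonneg[of V E p \<omega>] assms(2) by (simp add: graph_path_iff_walk)
qed

lemma graph_dist_triangle:
  assumes "connected_graph V E" "weight_function E \<omega>" "u \<in> V" "v \<in> V" "w \<in> V"
  shows "graph_dist V E \<omega> u w \<le> graph_dist V E \<omega> u v + graph_dist V E \<omega> v w"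
proof -
  have fin: "finite V" using assms by (auto simp: connected_graph_def finite_graph_def)
  obtain p where p: "graph_path V E p" "hd p = u" "last p = v"
    "path_weight \<omega> p = graph_dist V E \<omega> u v"
    using graph_dist_attained[OF assms(1,3,4)] .
  obtain q where q: "graph_path V E q" "hd q = v" "last q = w"
    "path_weight \<omega> q = graph_dist V E \<omega> v w"
    using graph_dist_attained[OF assms(1,4,5)] .
  have "graph_walk V E p" "graph_walk V E q" "last p = hd q"
    using p q by (auto simp: graph_path_iff_walk)
  note r = graph_walk_append[OF this]
  show ?thesis
    using graph_dist_le_walk[OF fin assms(2) r(1)] r(2-4) p q by simp
qed

section \<open>A covering walk in a connected graph\<close>

lemma successively_leaves_set:
  assumes "successively R p" "p \<noteq> []" "hd p \<in> S" "last p \<notin> S"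
  shows "\<exists>x y. x \<in> S \<and> y \<notin> S \<and> y \<in> set p \<and> R x y"
  using assms
proof (induction p rule: induct_list012)
  case (3 x y zs)
  show ?case
  proof (cases "y \<in> S")
    case True
    then have "\<exists>x y'. x \<in> S \<and> y' \<notin> S \<and> y' \<in> set (y # zs) \<and> R x y'"
      using 3 by (intro "3.IH"(2)) simp_all
    then show ?thesis by (meson list.set_intros(2))
  next
    case False
    moreover have "x \<in> S" "R x y" using 3 by simp_all
    ultimately show ?thesis by (intro exI[of _ x] exI[of _ y]) simp
  qed
qed simp_all

lemma path_weight_distinct_edges:
  assumes "graph_path V E p"
  shows "\<exists>F\<subseteq>E. finite F \<and> (\<forall>e\<in>F. e \<subseteq> set p) \<and> path_weight \<omega> p = sum \<omega> F"
  using assms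
proof (induction p rule: induct_list012)
  case (2 x)
  show ?case by (intro exI[of _ "{}"]) (simp add: path_weight_def)
next
  case (3 x y zs)
  have "graph_path V E (y # zs)" using "3.prems" by (simp add: graph_path_def)
  then obtain F where F: "F \<subseteq> E" "finite F" "\<forall>e\<in>F. e \<subseteq> set (y # zs)"
    "path_weight \<omega> (y # zs) = sum \<omega> F"
    using "3.IH"(2) by blast
  have "x \<notin> set (y # zs)" using "3.prems" by (simp add: graph_path_def)
  then have "{x, y} \<notin> F" using F(3) by blast
  then have "path_weight \<omega> (x # y # zs) = sum \<omega> (insert {x, y} F)"
    using F by (simp add: path_weight_eq_chain_sum)
  moreover have "{x, y} \<in> E" using "3.prems" by (simp add: graph_path_def)
  moreover have "\<forall>e\<in>insert {x, y} F. e \<subseteq> set (x # y # zs)" using F(3) by auto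
  ultimately show ?case
    using F by (intro exI[of _ "insert {x, y} F"]) simp
qed (simp add: graph_path_def)

text \<open>
  A walk inside a connected graph grows to one through all vertices by inserting detours
  \<open>s, t, s\<close> to new vertices \<open>t\<close>.  The edges already paid for, collected in \<open>F\<close>, lie inside the
  vertex set of the walk, so every detour uses a new edge.
\<close>

lemma extend_walk_to_cover:
  assumes conn: "connected_graph V E" and weight: "weight_function E \<omega>"
    and "graph_walk V E W" "F \<subseteq> E" "\<forall>e\<in>F. e \<subseteq> set W"
  shows "\<exists>W'. graph_walk V E W' \<and> set W' = V \<and> hd W' = hd W \<and> last W' = last W \<and>
    path_weight \<omega> W' \<le> path_weight \<omega> W + 2 * (graph_weight E \<omega> - sum \<omega> F)"
  using assms(3-)
proof (induction "card (V - set W)" arbitrary: W F rule: less_induct)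
  case less
  have fin: "finite V" "finite E"
    using conn finite_subset[of E "Pow V"] by (auto simp: connected_graph_def finite_graph_def)
  show ?case
  proof (cases "set W = V")
    case True
    have "sum \<omega> F \<le> graph_weight E \<omega>"
      unfolding graph_weight_def
      using less.prems weight fin by (intro sum_mono2) (auto simp: weight_function_def)
    then show ?thesis using less.prems True by (intro exI[of _ W]) simp
  next
    case False
    then obtain v where v: "v \<in> V" "v \<notin> set W"
      using less.prems by (auto simp: graph_walk_def)
    have "hd W \<in> set W" "hd W \<in> V" using less.prems by (auto simp: graph_walk_def)
    obtain p where p: "graph_path V E p" "hd p = hd W" "last p = v"
      "path_weight \<omega> p = graph_dist V E \<omega> (hd W) v"
      by (rule graph_dist_attained[OF conn \<open>hd W \<in> V\<close> v(1)])
    have "\<exists>s t. s \<in> set W \<and> t \<notin> set W \<and> t \<in> set p \<and> {s, t} \<in> E"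
      using p v \<open>hd W \<in> set W\<close>
      by (intro successively_leaves_set) (simp_all add: graph_path_def)
    then obtain s t where st: "s \<in> set W" "t \<notin> set W" "t \<in> set p" "{s, t} \<in> E"
      by blast
    have "t \<in> V" using st p by (auto simp: graph_path_def)
    obtain xs ys where W: "W = xs @ s # ys"
      using st by (auto simp: in_set_conv_decomp)
    let ?W = "xs @ s # t # s # ys"
    have walk: "graph_walk V E ?W"
      using less.prems(1) \<open>t \<in> V\<close> st(4) unfolding W graph_walk_def
      by (auto simp: successively_append_iff successively_Cons insert_commute)
    have pw: "path_weight \<omega> ?W = path_weight \<omega> W + 2 * \<omega> {s, t}"
      unfolding W path_weight_eq_chain_sum
      using chain_sum_append[of _ xs s "t # s # ys"] chain_sum_append[of _ xs s ys]
      by (simp add: insert_commute)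
    have ends: "hd ?W = hd W" "last ?W = last W"
      by (cases xs; simp add: W) (simp add: W)
    have set: "set ?W = insert t (set W)" by (auto simp: W)
    have "{s, t} \<notin> F" using less.prems(3) st by auto
    moreover have "finite F" using less.prems fin finite_subset by blast
    ultimately have sumF: "sum \<omega> (insert {s, t} F) = \<omega> {s, t} + sum \<omega> F" by simp
    have "card (V - set ?W) < card (V - set W)"
      using fin \<open>t \<in> V\<close> st(2) unfolding set by (intro psubset_card_mono) auto
    from less.hyps[OF this walk, of "insert {s, t} F"] obtain W' where
      "graph_walk V E W'" "set W' = V" "hd W' = hd ?W" "last W' = last ?W"
      "path_weight \<omega> W' \<le> path_weight \<omega> ?W + 2 * (graph_weight E \<omega> - sum \<omega> (insert {s, t} F))"
      using less.prems st unfolding set by auto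
    then show ?thesis
      using ends pw sumF by (intro exI[of _ W']) auto
  qed
qed

text \<open>
  The walk \<open>W\<close> arises from the reverse of \<open>P\<close> by detours.  Each edge of \<open>P\<close> is paid for once by
  \<open>P\<close> and once by \<open>W\<close>, and each edge of a detour twice by \<open>W\<close>.
\<close>

lemma covering_walk:
  assumes "connected_graph V E" "weight_function E \<omega>" "graph_path V E P"
  obtains W where "graph_walk V E W" "set W = V" "hd W = last P" "last W = hd P"
    "path_weight \<omega> P + path_weight \<omega> W \<le> 2 * graph_weight E \<omega>"
proof -
  obtain F where F: "F \<subseteq> E" "\<forall>e\<in>F. e \<subseteq> set (rev P)" "path_weight \<omega> P = sum \<omega> F"
    using path_weight_distinct_edges[OF assms(3), of \<omega>] by (auto simp only: set_rev)
  have "graph_walk V E (rev P)"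
    using assms(3) by (simp add: graph_path_iff_walk graph_walk_rev)
  from extend_walk_to_cover[OF assms(1,2) this F(1,2)] obtain W where
    W: "graph_walk V E W" "set W = V" "hd W = hd (rev P)" "last W = last (rev P)"
    "path_weight \<omega> W \<le> path_weight \<omega> (rev P) + 2 * (graph_weight E \<omega> - sum \<omega> F)"
    by blast
  have "path_weight \<omega> (rev P) = path_weight \<omega> P"
    unfolding path_weight_eq_chain_sum by (rule chain_sum_rev) (simp add: insert_commute)
  then have "path_weight \<omega> P + path_weight \<omega> W \<le> 2 * graph_weight E \<omega>"
    using W(5) F(3) by (simp add: right_diff_distrib)
  moreover have "P \<noteq> []" using assms(3) by (simp add: graph_path_def)
  then have "hd W = last P" "last W = hd P"
    using W(3,4) by (simp_all add: hd_rev last_rev)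
  ultimately show ?thesis by (intro that[of W] W(1,2))
qed

text \<open>
  The walk of \<open>covering_walk\<close> along a shortest path from \<open>p\<close> to \<open>q\<close>, restricted to the points
  of \<open>M\<close>.
\<close>

lemma filling_closed_chain:
  assumes fill: "filling M \<rho> V E \<omega>" and "p \<in> M" "q \<in> M"
  obtains m where "m \<noteq> []" "set m = M" "hd m = q" "last m = p"
    "graph_dist V E \<omega> p q + chain_sum \<rho> m \<le> 2 * graph_weight E \<omega>"
proof -
  let ?d = "graph_dist V E \<omega>"
  have conn: "connected_graph V E" and MV: "M \<subseteq> V" and weight: "weight_function E \<omega>"
    and le: "\<And>x y. x \<in> M \<Longrightarrow> y \<in> M \<Longrightarrow> \<rho> x y \<le> ?d x y"
    using fill by (auto simp: filling_def joins_def)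
  have fin: "finite V" using conn by (auto simp: connected_graph_def finite_graph_def)
  obtain P where P: "graph_path V E P" "hd P = p" "last P = q" "path_weight \<omega> P = ?d p q"
    by (rule graph_dist_attained[OF conn subsetD[OF MV \<open>p \<in> M\<close>] subsetD[OF MV \<open>q \<in> M\<close>]])
  obtain W where W: "graph_walk V E W" "set W = V" "hd W = q" "last W = p"
    "?d p q + path_weight \<omega> W \<le> 2 * graph_weight E \<omega>"
    using covering_walk[OF conn weight P(1)] unfolding P(2-4) .
  obtain xs where Wq: "W = q # xs" using W by (cases W) (auto simp: graph_walk_def)
  let ?m = "filter (\<lambda>x. x \<in> M) W"
  have m: "?m = q # filter (\<lambda>x. x \<in> M) xs" using Wq assms by simp
  have setm: "set ?m = M" using W MV by auto
  have lastm: "last ?m = p"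
  proof -
    have "W = butlast W @ [p]" using W(4) Wq append_butlast_last_id[of W] by simp
    then have "?m = filter (\<lambda>x. x \<in> M) (butlast W @ [p])" by (rule arg_cong)
    then show ?thesis using assms(2) by simp
  qed
  have "chain_sum \<rho> ?m \<le> chain_sum ?d ?m"
    by (rule chain_sum_mono) (use setm le in auto)
  also have "\<dots> \<le> chain_sum ?d W"
    unfolding m unfolding Wq
  proof (rule chain_sum_filter_le)
    show "set (q # xs) \<subseteq> V" using W(2) Wq by simp
  qed (rule graph_dist_triangle[OF conn weight] graph_dist_nonneg[OF conn weight]; assumption)+
  also have "\<dots> \<le> path_weight \<omega> W"
  proof -
    have "successively (\<lambda>x y. {x, y} \<in> E) W" using W by (simp add: graph_walk_def)
    moreover have "?d x y \<le> \<omega> {x, y}" if "{x, y} \<in> E" "x \<in> set W" "y \<in> set W" for x y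
      using graph_dist_le_walk[OF fin weight, of "[x, y]"] that W(2)
      by (simp add: graph_walk_def path_weight_eq_chain_sum)
    ultimately show ?thesis
      unfolding path_weight_eq_chain_sum by (rule chain_sum_mono_successively)
  qed
  finally show ?thesis
    using W(5) m setm lastm by (intro that[of ?m]) auto
qed

section \<open>Edge cuts of a tree\<close>

lemma tree_edge_is_bridge:
  assumes tree: "graph_tree V E" and e: "{a, b} \<in> E"
    and p: "graph_walk V (E - {{a, b}}) p" "hd p = a" "last p = b"
  shows False
proof -
  have "a \<noteq> b"
    using tree e by (auto simp: graph_tree_def connected_graph_def finite_graph_def)
  have "weight_function (E - {{a, b}}) (\<lambda>_. 0)" by (simp add: weight_function_def)
  then obtain q where q: "graph_path V (E - {{a, b}}) q" "hd q = a" "last q = b"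
    using walk_contains_path[OF p(1)] p(2,3) by metis
  have "3 \<le> length q"
  proof -
    have "q \<noteq> []" using q(1) by (simp add: graph_path_def)
    moreover have "q \<noteq> [a]" using q(3) \<open>a \<noteq> b\<close> by (metis last_ConsL)
    moreover have "q \<noteq> [a, b]"
    proof
      assume "q = [a, b]"
      then show False using q(1) by (simp add: graph_path_def)
    qed
    moreover have "q = [a]" if "length q = 1"
      using that q by (auto simp: length_Suc_conv)
    moreover have "q = [a, b]" if "length q = 2"
      using that q by (auto simp: length_Suc_conv numeral_2_eq_2)
    ultimately have "length q \<noteq> 0" "length q \<noteq> 1" "length q \<noteq> 2"
      by auto
    then show ?thesis by linarith
  qed
  moreover have "graph_path V E q"
    using q(1) unfolding graph_path_def by (auto elim: successively_mono)
  ultimately have "graph_cycle V E q"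
    using q e by (simp add: graph_cycle_def insert_commute)
  then show False using tree by (auto simp: graph_tree_def)
qed

text \<open>The last vertex of a longest path that starts with \<open>b, a\<close> is a leaf.\<close>

lemma tree_leaf_beyond_edge:
  assumes tree: "graph_tree V E" and e: "{a, b} \<in> E"
  obtains p where "graph_walk V (E - {{a, b}}) p" "hd p = a" "degree E (last p) = 1"
proof -
  have gr: "finite V" "\<And>e. e \<in> E \<Longrightarrow> e \<subseteq> V \<and> card e = 2"
    using tree by (auto simp: graph_tree_def connected_graph_def finite_graph_def)
  have "a \<noteq> b" using gr(2)[OF e] by auto
  have "graph_path V E (b # a # [])"
    using gr(2)[OF e] e \<open>a \<noteq> b\<close> by (auto simp: graph_path_def insert_commute)
  moreover have "length r < Suc (card V)" if "graph_path V E (b # a # r)" for r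
  proof -
    have "length r = card (set r)" using that by (simp add: graph_path_def distinct_card)
    also have "\<dots> \<le> card V" using that gr(1) by (intro card_mono) (auto simp: graph_path_def)
    finally show ?thesis by simp
  qed
  ultimately obtain r where r: "graph_path V E (b # a # r)"
    and maximal: "\<And>r'. graph_path V E (b # a # r') \<Longrightarrow> length r' \<le> length r"
    using ex_has_greatest_nat[of "\<lambda>r. graph_path V E (b # a # r)" "[]" length "Suc (card V)"] by auto
  let ?q = "b # a # r"
  define v where "v = last (a # r)"
  obtain xs u where q: "?q = xs @ [u, v]"
  proof -
    have "?q = (b # butlast (a # r)) @ [v]" by (simp add: v_def)
    also have "b # butlast (a # r) =
        butlast (b # butlast (a # r)) @ [last (b # butlast (a # r))]"
      by (rule append_butlast_last_id[symmetric]) simp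
    finally show ?thesis by (intro that) simp
  qed
  have uv: "{u, v} \<in> E"
    using r unfolding q by (auto simp: graph_path_def successively_append_iff)
  have only: "f = {u, v}" if f: "f \<in> E" "v \<in> f" for f
  proof (rule ccontr)
    assume "f \<noteq> {u, v}"
    from f gr(2)[OF f(1)] obtain w where w: "f = {v, w}" "w \<noteq> v" "w \<in> V"
      by (auto simp: card_2_iff)
    have "w \<noteq> u" using \<open>f \<noteq> {u, v}\<close> w by auto
    show False
    proof (cases "w \<in> set ?q")
      case False
      have "graph_path V E (?q @ [w])"
        using r False w f(1) unfolding q by (auto simp: graph_path_def successively_append_iff)
      then show False using maximal[of "r @ [w]"] by simp
    next
      case True
      then have "w \<in> set xs" using w \<open>w \<noteq> u\<close> unfolding q by auto
      then obtain ys zs where "xs = ys @ w # zs" by (auto simp: in_set_conv_decomp)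
      then have "graph_cycle V E (w # zs @ [u, v])"
        using r w f(1) unfolding q
        by (auto simp: graph_cycle_def graph_path_def successively_append_iff)
      then show False using tree by (auto simp: graph_tree_def)
    qed
  qed
  have "{f \<in> E. v \<in> f} = {{u, v}}"
  proof (intro equalityI subsetI)
    fix f assume "f \<in> {f \<in> E. v \<in> f}"
    then show "f \<in> {{u, v}}" using only[of f] by simp
  qed (simp add: uv)
  then have "degree E v = 1" by (simp add: degree_def)
  moreover have "graph_walk V (E - {{a, b}}) (a # r)"
  proof -
    have "successively (\<lambda>x y. {x, y} \<in> E) (a # r)" using r by (simp add: graph_path_def)
    then have "successively (\<lambda>x y. {x, y} \<in> E - {{a, b}}) (a # r)"
    proof (rule successively_mono)
      fix x y
      assume xy: "x \<in> set (a # r)" "y \<in> set (a # r)" "{x, y} \<in> E"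
      have "b \<notin> set (a # r)" using r by (simp add: graph_path_def)
      then have "b \<notin> {x, y}" using xy by blast
      then have "{x, y} \<noteq> {a, b}" by blast
      then show "{x, y} \<in> E - {{a, b}}" using xy by simp
    qed
    then show ?thesis using r by (simp add: graph_walk_def graph_path_def)
  qed
  ultimately show ?thesis using that[of "a # r"] by (simp add: v_def)
qed

text \<open>
  \<open>A\<close> is one side of a cut across which \<open>e\<close> is the only edge; \<open>A\<close> may contain points outside
  the vertex set.
\<close>

definition edge_cut :: "'a set set \<Rightarrow> 'a set \<Rightarrow> 'a set \<Rightarrow> bool" where
  "edge_cut E e A \<longleftrightarrow> (\<forall>x y. {x, y} \<in> E \<longrightarrow> ((x \<in> A) \<noteq> (y \<in> A) \<longleftrightarrow> {x, y} = e))"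

text \<open>
  Every edge of the tree is the only edge across some cut, and this cut separates \<open>M\<close>, because
  both of its sides contain leaves.
\<close>

lemma admissible_tree_cut:
  assumes adm: "admissible_weighted_tree M V E \<omega>" and "e \<in> E"
  obtains A where "edge_cut E e A" "M \<inter> A \<noteq> {}" "M - A \<noteq> {}"
proof -
  have tree: "graph_tree V E" and
    leaf: "\<And>v. v \<in> V \<Longrightarrow> degree E v = 1 \<Longrightarrow> v \<in> M"
    using adm by (auto simp: admissible_weighted_tree_def)
  have gr: "\<And>e. e \<in> E \<Longrightarrow> e \<subseteq> V \<and> card e = 2"
    using tree by (auto simp: graph_tree_def connected_graph_def finite_graph_def)
  obtain a b where ab: "e = {a, b}" "a \<noteq> b" "a \<in> V" "b \<in> V"
    using gr[OF \<open>e \<in> E\<close>] by (auto simp: card_2_iff)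
  \<comment> \<open>The component of \<open>a\<close> after removal of \<open>e\<close>\<close>
  define A where "A = {v. \<exists>p. graph_walk V (E - {e}) p \<and> hd p = a \<and> last p = v}"
  have "a \<in> A"
    unfolding A_def using ab by (auto intro!: exI[of _ "[a]"] simp: graph_walk_def)
  have "b \<notin> A"
    using tree_edge_is_bridge[OF tree] \<open>e \<in> E\<close> unfolding A_def ab(1) by blast
  have step: "y \<in> A" if "x \<in> A" "graph_walk V (E - {e}) q" "hd q = x" "last q = y" for x y q
  proof -
    obtain p where "graph_walk V (E - {e}) p" "hd p = a" "last p = x"
      using \<open>x \<in> A\<close> by (auto simp: A_def)
    with graph_walk_append[of V "E - {e}" p q] that show ?thesis
      unfolding A_def by auto
  qed
  have "(x \<in> A) \<noteq> (y \<in> A) \<longleftrightarrow> {x, y} = e" if "{x, y} \<in> E" for x y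
  proof (cases "{x, y} = e")
    case True
    then show ?thesis using \<open>a \<in> A\<close> \<open>b \<notin> A\<close> by (auto simp: ab(1) doubleton_eq_iff)
  next
    case False
    then have "graph_walk V (E - {e}) [x, y]" "graph_walk V (E - {e}) [y, x]"
      using that gr[OF that] by (auto simp: graph_walk_def insert_commute)
    then show ?thesis
      using False step[of x "[x, y]" y] step[of y "[y, x]" x] by auto
  qed
  then have "edge_cut E e A" by (simp add: edge_cut_def)
  moreover have "M \<inter> A \<noteq> {}"
  proof -
    obtain p where p: "graph_walk V (E - {e}) p" "hd p = a" "degree E (last p) = 1"
      using tree_leaf_beyond_edge[OF tree] \<open>e \<in> E\<close> ab(1) by blast
    then have "last p \<in> V" by (auto simp: graph_walk_def)
    then show ?thesis using leaf p by (auto simp: A_def)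
  qed
  moreover have "M - A \<noteq> {}"
  proof -
    have "e = {b, a}" using ab by auto
    then obtain p where p: "graph_walk V (E - {e}) p" "hd p = b" "degree E (last p) = 1"
      using tree_leaf_beyond_edge[OF tree] \<open>e \<in> E\<close> by blast
    then have V: "last p \<in> V" by (auto simp: graph_walk_def)
    have "p \<noteq> []" using p by (simp add: graph_walk_def)
    then have "last p \<notin> A"
      using step[OF _ graph_walk_rev[OF p(1)]] p(2) \<open>b \<notin> A\<close> by (auto simp: hd_rev last_rev)
    then show ?thesis using leaf[OF V p(3)] by auto
  qed
  ultimately show ?thesis using that by blast
qed

section \<open>Minimal fillings of additive spaces\<close>

text \<open>
  The proof only needs that the tree metric dominates the cut metric \<open>D\<close>, the sum over the
  edges \<open>e\<close> of \<open>\<omega> e\<close> times the indicator \<open>\<delta> e\<close> of being separated by the cut of \<open>e\<close>.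
\<close>

lemma admissible_tree_closed_chain_ge:
  assumes adm: "admissible_weighted_tree M V E \<omega>" and m: "m \<noteq> []" "set m = M"
  shows "2 * graph_weight E \<omega> \<le>
    chain_sum (graph_dist V E \<omega>) m + graph_dist V E \<omega> (last m) (hd m)"
proof -
  let ?d = "graph_dist V E \<omega>"
  have conn: "connected_graph V E" and weight: "weight_function E \<omega>" and MV: "M \<subseteq> V"
    using adm by (auto simp: admissible_weighted_tree_def joins_def)
  have finE: "finite E"
    using conn finite_subset[of E "Pow V"] by (auto simp: connected_graph_def finite_graph_def)
  have "\<forall>e\<in>E. \<exists>A. edge_cut E e A \<and> M \<inter> A \<noteq> {} \<and> M - A \<noteq> {}"
    using admissible_tree_cut[OF adm] by metis
  then obtain A where cut: "\<And>e. e \<in> E \<Longrightarrow> edge_cut E e (A e)" and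
    sides: "\<And>e. e \<in> E \<Longrightarrow> M \<inter> A e \<noteq> {} \<and> M - A e \<noteq> {}"
    by metis
  define \<delta> where "\<delta> e x y = (of_bool ((x \<in> A e) \<noteq> (y \<in> A e)) :: real)" for e x y
  define D where "D = (\<lambda>x y. \<Sum>e\<in>E. \<omega> e * \<delta> e x y)"
  have \<delta>: "\<delta> e x z \<le> \<delta> e x y + \<delta> e y z" "\<delta> e x x = 0" "\<delta> e x y = \<delta> e y x" for e x y z
    by (auto simp: \<delta>_def)
  have D_tri: "D x z \<le> D x y + D y z" for x y z
    unfolding D_def sum.distrib[symmetric] distrib_left[symmetric]
    using weight \<delta>(1) by (intro sum_mono mult_left_mono) (auto simp: weight_function_def)
  have D_edge: "D x y = \<omega> {x, y}" if "{x, y} \<in> E" for x y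
  proof -
    have "\<omega> e * \<delta> e x y = (if e = {x, y} then \<omega> e else 0)" if "e \<in> E" for e
    proof -
      have "(x \<in> A e) \<noteq> (y \<in> A e) \<longleftrightarrow> {x, y} = e"
        using cut[OF that] \<open>{x, y} \<in> E\<close> unfolding edge_cut_def by blast
      then show ?thesis unfolding \<delta>_def by (cases "{x, y} = e") auto
    qed
    then have "D x y = (\<Sum>e\<in>E. if e = {x, y} then \<omega> e else 0)"
      unfolding D_def by (intro sum.cong) simp_all
    then show ?thesis using finE that by simp
  qed
  have D_le: "D x y \<le> ?d x y" if xy: "x \<in> M" "y \<in> M" for x y
  proof -
    obtain p where p: "graph_path V E p" "hd p = x" "last p = y" "path_weight \<omega> p = ?d x y"
      by (rule graph_dist_attained[OF conn subsetD[OF MV xy(1)] subsetD[OF MV xy(2)]])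
    have succ: "successively (\<lambda>x y. {x, y} \<in> E) p" "p \<noteq> []"
      using p by (auto simp: graph_path_def)
    have "D (hd p) (last p) \<le> chain_sum D p"
      by (rule triangle_chain_sum[OF D_tri _ succ(2)]) (simp add: D_def \<delta>(2))
    also have "\<dots> \<le> path_weight \<omega> p"
      unfolding path_weight_eq_chain_sum
      by (rule chain_sum_mono_successively[OF succ(1)]) (simp add: D_edge)
    finally show ?thesis using p by simp
  qed
  have two: "2 \<le> chain_sum (\<delta> e) m + \<delta> e (last m) (hd m)" if e: "e \<in> E" for e
  proof -
    obtain y z where yz: "y \<in> M" "y \<in> A e" "z \<in> M" "z \<notin> A e"
      using sides[OF e] by blast
    define x where "x = (if hd m \<in> A e then z else y)"
    have x: "x \<in> set m" and "\<delta> e (hd m) x = 1"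
      using yz m(2) by (simp_all add: x_def \<delta>_def)
    moreover have "2 * \<delta> e (hd m) x \<le> chain_sum (\<delta> e) m + \<delta> e (last m) (hd m)"
      by (rule closed_chain_ge) (rule \<delta> x)+
    ultimately show ?thesis by linarith
  qed
  have "2 * graph_weight E \<omega> = (\<Sum>e\<in>E. \<omega> e * 2)"
    by (simp add: graph_weight_def mult.commute flip: sum_distrib_right)
  also have "\<dots> \<le> (\<Sum>e\<in>E. \<omega> e * (chain_sum (\<delta> e) m + \<delta> e (last m) (hd m)))"
  proof (intro sum_mono mult_left_mono)
    show "0 \<le> \<omega> e" if "e \<in> E" for e
      using weight that by (simp add: weight_function_def)
  qed (rule two)
  also have "\<dots> = chain_sum D m + D (last m) (hd m)"
  proof -
    have "chain_sum D m = (\<Sum>e\<in>E. \<omega> e * chain_sum (\<delta> e) m)"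
      unfolding D_def by (rule chain_sum_sum)
    moreover have "D (last m) (hd m) = (\<Sum>e\<in>E. \<omega> e * \<delta> e (last m) (hd m))"
      by (simp only: D_def)
    ultimately show ?thesis by (simp only: distrib_left sum.distrib)
  qed
  also have "\<dots> \<le> chain_sum ?d m + ?d (last m) (hd m)"
  proof (rule add_mono)
    show "chain_sum D m \<le> chain_sum ?d m"
      by (rule chain_sum_mono) (simp add: D_le m(2))
    show "D (last m) (hd m) \<le> ?d (last m) (hd m)"
      using m by (intro D_le) auto
  qed
  finally show ?thesis .
qed

lemma generating_tree_closed_chain_ge:
  assumes gen: "generating_tree M \<rho> V E \<omega>" and m: "m \<noteq> []" "set m = M"
  shows "2 * graph_weight E \<omega> \<le> chain_sum \<rho> m + \<rho> (last m) (hd m)"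
proof -
  have eq: "\<And>x y. x \<in> M \<Longrightarrow> y \<in> M \<Longrightarrow> graph_dist V E \<omega> x y = \<rho> x y"
    and adm: "admissible_weighted_tree M V E \<omega>"
    using gen by (auto simp: generating_tree_def)
  have "chain_sum (graph_dist V E \<omega>) m \<le> chain_sum \<rho> m"
    by (rule chain_sum_mono) (simp add: eq m)
  moreover have "graph_dist V E \<omega> (last m) (hd m) = \<rho> (last m) (hd m)"
    using m by (intro eq) auto
  ultimately show ?thesis
    using admissible_tree_closed_chain_ge[OF adm m] by simp
qed

lemma generating_tree_weight_le_filling:
  assumes "finite_pseudo_metric_space M \<rho>" "generating_tree M \<rho> V E \<omega>" "filling M \<rho> V' E' \<omega>'"
  shows "graph_weight E \<omega> \<le> graph_weight E' \<omega>'"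
proof (cases "M = {}")
  case True
  \<comment> \<open>A tree with an edge has leaves, and these belong to \<open>M\<close>.\<close>
  have "E = {}"
  proof (rule ccontr)
    assume "E \<noteq> {}"
    then obtain e where "e \<in> E" by blast
    moreover have "admissible_weighted_tree M V E \<omega>"
      using assms(2) by (simp add: generating_tree_def)
    ultimately show False using admissible_tree_cut[of M V E \<omega> e] True by blast
  qed
  then show ?thesis
    using assms(3)
    by (auto simp: graph_weight_def filling_def weight_function_def intro: sum_nonneg)
next
  case False
  then obtain p where "p \<in> M" by blast
  then have "\<rho> p p = 0" using assms(1) by (simp add: finite_pseudo_metric_space_def)
  obtain m where m: "m \<noteq> []" "set m = M" "hd m = p" "last m = p"
    "graph_dist V' E' \<omega>' p p + chain_sum \<rho> m \<le> 2 * graph_weight E' \<omega>'"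
    using filling_closed_chain[OF assms(3) \<open>p \<in> M\<close> \<open>p \<in> M\<close>] .
  have "\<rho> p p \<le> graph_dist V' E' \<omega>' p p"
    using assms(3) \<open>p \<in> M\<close> by (simp add: filling_def)
  then show ?thesis
    using generating_tree_closed_chain_ge[OF assms(2) m(1,2)] m \<open>\<rho> p p = 0\<close> by simp
qed

lemma generating_tree_is_filling:
  "generating_tree M \<rho> V E \<omega> \<Longrightarrow> filling M \<rho> V E \<omega>"
  by (simp add: generating_tree_def admissible_weighted_tree_def filling_def)

lemma mf_eq_generating_tree_weight:
  assumes "finite_pseudo_metric_space M \<rho>" "generating_tree M \<rho> V E \<omega>"
  shows "mf M \<rho> = graph_weight E \<omega>"
  unfolding mf_def
proof (rule cInf_eq_minimum)
  show "graph_weight E \<omega> \<in> {graph_weight E \<omega> | V E \<omega>. filling M \<rho> V E \<omega>}"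
    using generating_tree_is_filling[OF assms(2)] by blast
  show "graph_weight E \<omega> \<le> x"
    if "x \<in> {graph_weight E \<omega> | V E \<omega>. filling M \<rho> V E \<omega>}" for x
    using that generating_tree_weight_le_filling[OF assms] by blast
qed

theorem theorem9p1:
  fixes M :: "'a::infinite set" and \<rho> :: "'a \<Rightarrow> 'a \<Rightarrow> real"
    and V :: "'a set" and E :: "'a set set" and \<omega> :: "'a set \<Rightarrow> real"
  assumes "additive_space M \<rho>"
    and "admissible_weighted_tree M V E \<omega>"
  shows "minimal_filling M \<rho> V E \<omega> \<longleftrightarrow> generating_tree M \<rho> V E \<omega>"
proof
  have met: "finite_pseudo_metric_space M \<rho>"
    using assms(1) by (simp add: additive_space_def)
  show "minimal_filling M \<rho> V E \<omega>" if "generating_tree M \<rho> V E \<omega>"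
    using that mf_eq_generating_tree_weight[OF met that]
    by (simp add: minimal_filling_def generating_tree_is_filling)
  show "generating_tree M \<rho> V E \<omega>" if min: "minimal_filling M \<rho> V E \<omega>"
  proof -
    obtain V0 E0 \<omega>0 where gen: "generating_tree M \<rho> V0 E0 \<omega>0"
      using assms(1) by (auto simp: additive_space_def)
    have fill: "filling M \<rho> V E \<omega>" and weight: "graph_weight E \<omega> = graph_weight E0 \<omega>0"
      using min mf_eq_generating_tree_weight[OF met gen] by (auto simp: minimal_filling_def)
    have "\<rho> p q = graph_dist V E \<omega> p q" if pq: "p \<in> M" "q \<in> M" for p q
    proof (rule antisym)
      show "\<rho> p q \<le> graph_dist V E \<omega> p q"
        using fill pq by (simp add: filling_def)
      obtain m where m: "m \<noteq> []" "set m = M" "hd m = q" "last m = p"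
        "graph_dist V E \<omega> p q + chain_sum \<rho> m \<le> 2 * graph_weight E \<omega>"
        using filling_closed_chain[OF fill pq] .
      then show "graph_dist V E \<omega> p q \<le> \<rho> p q"
        using generating_tree_closed_chain_ge[OF gen m(1,2)] weight by simp
    qed
    then show ?thesis using assms(2) by (simp add: generating_tree_def)
  qed
qed

end
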